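(* Let $\lambda,\mu,\nu$ be Young diagrams. With the functions $F$ and $\widetilde F$ and the Jeffrey--Kirwan prescription defined in the context, the PT3 partition function $\mathcal{Z}^{\mathrm{PT}}_{\lambda\mu\nu}=\sum_{k\ge0}\mathfrak q^k\mathcal Z^{\mathrm{PT}}_{\lambda\mu\nu}[k]$, whose $k$-th coefficient is defined by the integrand built from $F$ with reference vector $\tilde\eta_0=(-1,\dots,-1)$, can also be computed from the conjugate integrand built from $\widetilde F$ with reference vector $\eta_0=(1,\dots,1)$: for every $k\ge0$, $$\mathcal Z^{\mathrm{PT}}_{\lambda\mu\nu}[k]=\frac1{k!}\left(\frac{\prod_{i=1}^3\mathrm{sh}(-\epsilon_i-\epsilon_4)}{\prod_{a=1}^4\mathrm{sh}(-\epsilon_a)}\right)^k\oint_{\eta_0}\prod_{I=1}^k\frac{d\phi_I}{2\pi i}\ \prod_{I=1}^k\widetilde F(\phi_I)\ \prod_{I\neq J}D(\phi_I-\phi_J).$$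
   Context: **Parameters.** $\epsilon_1,\dots,\epsilon_4\in\mathbb C$ satisfy $\epsilon_1+\epsilon_2+\epsilon_3+\epsilon_4=0$ and are otherwise generic; $\mathfrak a\in\mathbb C$; $\mathrm{sh}(x)=e^{x/2}-e^{-x/2}$; $\ell(\lambda)$ is the length of $\lambda$. **Minimal plane partition and corners.** Put $\mathcal B_\lambda=\{(a,b,c)\in\mathbb Z_{\ge1}^3: b\le \ell(\lambda),\ c\le\lambda_b\}$, $\mathcal B_\mu=\{(a,b,c): c\le\ell(\mu),\ a\le\mu_c\}$, $\mathcal B_\nu=\{(a,b,c): a\le \ell(\nu),\ b\le\nu_a\}$, $\mathcal B=\mathcal B_\lambda\cup\mathcal B_\mu\cup\mathcal B_\nu$. The polynomial $$K=(1-x_1)(1-x_2)(1-x_3)\sum_{(i,j,k)\in\mathbb Z_{\ge1}^3\setminus\mathcal B}x_1^{i-1}x_2^{j-1}x_3^{k-1}$$ has coefficients in $\{1,0,-1,-2\}$; let $s$ (concave corners), $p_1$ (half-convex corners), $p_2$ (full-convex corners) be the sets of $(i,j,k)$ for which the coefficient of $x_1^{i-1}x_2^{j-1}x_3^{k-1}$ is $1,-1,-2$ respectively. For $\square=(i,j,k)$ put $c(\square)=(i-1)\epsilon_1+(j-1)\epsilon_2+(k-1)\epsilon_3$. **Integrands.** $$D(\phi)=\frac{\mathrm{sh}(\phi)\prod_{i=1}^3\mathrm{sh}(\phi-\epsilon_i-\epsilon_4)}{\prod_{a=1}^4\mathrm{sh}(\phi-\epsilon_a)},$$ $$F(\phi)=\prod_{\square\in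 s}\frac{\mathrm{sh}(\phi-\mathfrak a-c(\square)-\epsilon_4)}{\mathrm{sh}(\phi-\mathfrak a-c(\square))}\prod_{m=1,2}\prod_{\square\in p_m}\left(\frac{\mathrm{sh}(\mathfrak a+c(\square)-\phi)}{\mathrm{sh}(\mathfrak a+c(\square)+\epsilon_4-\phi)}\right)^{m},$$ $$\widetilde F(\phi)=\prod_{\square\in s}\frac{\mathrm{sh}(\mathfrak a-c(\square)-\epsilon_4-\phi)}{\mathrm{sh}(\mathfrak a-c(\square)-\phi)}\prod_{m=1,2}\prod_{\square\in p_m}\left(\frac{\mathrm{sh}(\phi-\mathfrak a+c(\square))}{\mathrm{sh}(\phi-\mathfrak a+c(\square)+\epsilon_4)}\right)^{m}.$$ The PT3 partition function is defined by $$\mathcal Z^{\mathrm{PT}}_{\lambda\mu\nu}[k]=\frac1{k!}\left(\frac{\prod_{i=1}^3\mathrm{sh}(-\epsilon_i-\epsilon_4)}{\prod_{a=1}^4\mathrm{sh}(-\epsilon_a)}\right)^k\oint_{\tilde\eta_0}\prod_{I=1}^k\frac{d\phi_I}{2\pi i}\prod_{I=1}^kF(\phi_I)\prod_{I\ne J}D(\phi_I-\phi_J).$$ **Jeffrey--Kirwan residue.** $\phi\in(\mathbb C/2\pi i\mathbb Z)^k$. The denominator factors are: for $F$, $\mathrm{sh}(\phi_I-\mathfrak a-c(\square))$ with $\square\in s$ and $\mathrm{sh}(\mathfrak a+c(\square)+\epsilon_4-\phi_I)$ with $\square\in p_m$; for $\widetilde F$, $\mathrm{sh}(\mathfrak a-c(\square)-\phi_I)$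 with $\square\in s$ and $\mathrm{sh}(\phi_I-\mathfrak a+c(\square)+\epsilon_4)$ with $\square\in p_m$; and in both cases $\mathrm{sh}(\phi_I-\phi_J-\epsilon_a)$ with $I\ne J$, $a=1,\dots,4$. Each such factor $\mathrm{sh}(Q(\phi)+f)$, with the argument taken with precisely this sign, gives a singular hyperplane $Q(\phi)+f=0$ with charge $Q\in(\mathbb R^k)^*$ (thus $\pm e_I$ according to the sign of $\phi_I$ in the denominator factors of $F$ or $\widetilde F$, and $e_I-e_J$ for the factors $\mathrm{sh}(\phi_I-\phi_J-\epsilon_a)$). For a reference vector $\eta$, $\oint_\eta$ is the sum over all points $\phi_*$ at which $k$ linearly independent singular hyperplanes meet of the JK residue: if $Q_*$ is the set of charges of hyperplanes through $\phi_*$, it equals $$\sum_{\mathcal F}\delta(\mathcal F,\eta)\frac{\mathrm{sign}\det\kappa(\mathcal F)}{\det(Q_{j_1},\dots,Q_{j_k})}\mathop{\mathrm{Res}}_{\delta_k=0}\cdots\mathop{\mathrm{Res}}_{\delta_1=0}\ (\text{integrand})\big|_{Q_{j_i}(\phi)+f_{j_i}=\delta_i},$$ summed over distinct flags $\mathcal F_1\subset\dots\subset \mathcal F_k=\mathbb R^k$, $\mathcal F_i=\mathrm{span}(Q_{j_1},\dots,Q_{j_i})$ with $Q_{j_i}\in Q_*$ (one basis per flag); $\kappa(\mathcal F)=(\kappa_1,\dots,\kappa_k)$, $\kappa_i=\sum_{Q\in Q_*\cap \mathcal F_i}Q$; $\delta(\mathcal F,\eta)=1$ if $\eta$ lies in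 the closed cone spanned by $\kappa_1,\dots,\kappa_k$ and $0$ otherwise ($\eta$ being replaced by a generic nearby vector where needed). When exactly $k$ hyperplanes meet this is $\frac{1}{|\det Q|}$ times the iterated residue if $\eta\in\mathrm{Cone}(Q_1,\dots,Q_k)$, and $0$ otherwise. *)

theory Defs
  imports
    "HOL-Complex_Analysis.Complex_Analysis"
    "HOL-Computational_Algebra.Formal_Power_Series"
    "Jordan_Normal_Form.VS_Connect"
begin

unbundle no vec_syntax
unbundle no inner_syntax

text \<open>A Young diagram is the list of its positive row lengths; the row with (1-based) number
  \<open>b\<close> is \<open>lam ! (b - 1)\<close>. Boxes are triples of positive integers.\<close>

definition young_diagram :: "nat list \<Rightarrow> bool" where
  "young_diagram lam \<longleftrightarrow> sorted_wrt (\<ge>) lam \<and> (\<forall>r\<in>set lam. 0 < r)"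

type_synonym box = "nat \<times> nat \<times> nat"

definition leg1 :: "nat list \<Rightarrow> box set" where
  "leg1 lam = {(a, b, c). 1 \<le> a \<and> 1 \<le> b \<and> 1 \<le> c \<and> b \<le> length lam \<and> c \<le> lam ! (b - 1)}"

definition leg2 :: "nat list \<Rightarrow> box set" where
  "leg2 mu = {(a, b, c). 1 \<le> a \<and> 1 \<le> b \<and> 1 \<le> c \<and> c \<le> length mu \<and> a \<le> mu ! (c - 1)}"

definition leg3 :: "nat list \<Rightarrow> box set" where
  "leg3 nu = {(a, b, c). 1 \<le> a \<and> 1 \<le> b \<and> 1 \<le> c \<and> a \<le> length nu \<and> b \<le> nu ! (a - 1)}"

definition min_plane_partition :: "nat list \<Rightarrow> nat list \<Rightarrow> nat list \<Rightarrow> box set" where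
  "min_plane_partition lam mu nu = leg1 lam \<union> leg2 mu \<union> leg3 nu"

text \<open>Series in \<open>x\<^sub>1, x\<^sub>2, x\<^sub>3\<close> are iterated power series, \<open>x\<^sub>1\<close> being the outermost variable.
  Since the indices below start at 0, the monomial with exponents \<open>(i, j, k)\<close> belongs to the
  box \<open>(i + 1, j + 1, k + 1)\<close>.\<close>

definition corner_series ::
  "nat list \<Rightarrow> nat list \<Rightarrow> nat list \<Rightarrow> int fps fps fps" where
  "corner_series lam mu nu =
     (1 - fps_X) * (1 - fps_const fps_X) * (1 - fps_const (fps_const fps_X)) *
     Abs_fps (\<lambda>i. Abs_fps (\<lambda>j. Abs_fps (\<lambda>k.
       if (i + 1, j + 1, k + 1) \<in> min_plane_partition lam mu nu then 0 else 1)))"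

definition corners :: "nat list \<Rightarrow> nat list \<Rightarrow> nat list \<Rightarrow> int \<Rightarrow> box set" where
  "corners lam mu nu v = {(i, j, k). 1 \<le> i \<and> 1 \<le> j \<and> 1 \<le> k \<and>
     fps_nth (fps_nth (fps_nth (corner_series lam mu nu) (i - 1)) (j - 1)) (k - 1) = v}"

definition concave_corners :: "nat list \<Rightarrow> nat list \<Rightarrow> nat list \<Rightarrow> box set" where
  "concave_corners lam mu nu = corners lam mu nu 1"

text \<open>\<open>convex_corners lam mu nu m\<close> is the set \<open>p\<^sub>m\<close>: half-convex corners for \<open>m = 1\<close>,
  full-convex corners for \<open>m = 2\<close>.\<close>

definition convex_corners :: "nat list \<Rightarrow> nat list \<Rightarrow> nat list \<Rightarrow> nat \<Rightarrow> box set" where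
  "convex_corners lam mu nu m = corners lam mu nu (- int m)"

definition sh :: "complex \<Rightarrow> complex" where
  "sh x = exp (x / 2) - exp (- x / 2)"

text \<open>The parameters \<open>\<epsilon>\<^sub>1, \<dots>, \<epsilon>\<^sub>4\<close> are \<open>\<epsilon> 1, \<dots>, \<epsilon> 4\<close>. Genericity means that, apart from the
  multiples of \<open>\<epsilon>\<^sub>1 + \<epsilon>\<^sub>2 + \<epsilon>\<^sub>3 + \<epsilon>\<^sub>4 = 0\<close>, there is no integer linear relation between them
  modulo \<open>2\<pi>\<i>\<close>.\<close>

definition generic_eps :: "(nat \<Rightarrow> complex) \<Rightarrow> bool" where
  "generic_eps \<epsilon> \<longleftrightarrow>
     (\<forall>n1 n2 n3 m :: int.
        of_int n1 * \<epsilon> 1 + of_int n2 * \<epsilon> 2 + of_int n3 * \<epsilon> 3 = 2 * of_real pi * \<i> * of_int m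
        \<longrightarrow> n1 = 0 \<and> n2 = 0 \<and> n3 = 0)"

definition content :: "(nat \<Rightarrow> complex) \<Rightarrow> box \<Rightarrow> complex" where
  "content \<epsilon> = (\<lambda>(i, j, k).
     of_nat (i - 1) * \<epsilon> 1 + of_nat (j - 1) * \<epsilon> 2 + of_nat (k - 1) * \<epsilon> 3)"

definition D_fun :: "(nat \<Rightarrow> complex) \<Rightarrow> complex \<Rightarrow> complex" where
  "D_fun \<epsilon> \<phi> = sh \<phi> * (\<Prod>i\<in>{1..3}. sh (\<phi> - \<epsilon> i - \<epsilon> 4)) / (\<Prod>a\<in>{1..4}. sh (\<phi> - \<epsilon> a))"

definition F_fun ::
  "(nat \<Rightarrow> complex) \<Rightarrow> complex \<Rightarrow> nat list \<Rightarrow> nat list \<Rightarrow> nat list \<Rightarrow> complex \<Rightarrow> complex" where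
  "F_fun \<epsilon> \<aa> lam mu nu \<phi> =
     (\<Prod>b\<in>concave_corners lam mu nu.
        sh (\<phi> - \<aa> - content \<epsilon> b - \<epsilon> 4) / sh (\<phi> - \<aa> - content \<epsilon> b)) *
     (\<Prod>m\<in>{1, 2}. \<Prod>b\<in>convex_corners lam mu nu m.
        (sh (\<aa> + content \<epsilon> b - \<phi>) / sh (\<aa> + content \<epsilon> b + \<epsilon> 4 - \<phi>)) ^ m)"

definition F_conj_fun ::
  "(nat \<Rightarrow> complex) \<Rightarrow> complex \<Rightarrow> nat list \<Rightarrow> nat list \<Rightarrow> nat list \<Rightarrow> complex \<Rightarrow> complex" where
  "F_conj_fun \<epsilon> \<aa> lam mu nu \<phi> =
     (\<Prod>b\<in>concave_corners lam mu nu.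
        sh (\<aa> - content \<epsilon> b - \<epsilon> 4 - \<phi>) / sh (\<aa> - content \<epsilon> b - \<phi>)) *
     (\<Prod>m\<in>{1, 2}. \<Prod>b\<in>convex_corners lam mu nu m.
        (sh (\<phi> - \<aa> + content \<epsilon> b) / sh (\<phi> - \<aa> + content \<epsilon> b + \<epsilon> 4)) ^ m)"

definition integrand ::
  "(nat \<Rightarrow> complex) \<Rightarrow> (complex \<Rightarrow> complex) \<Rightarrow> nat \<Rightarrow> complex vec \<Rightarrow> complex" where
  "integrand \<epsilon> f k \<phi> =
     (\<Prod>I<k. f (\<phi> $ I)) *
     (\<Prod>(I, J)\<in>{(I, J). I < k \<and> J < k \<and> I \<noteq> J}. D_fun \<epsilon> (\<phi> $ I - \<phi> $ J))"

abbreviation vspan :: "nat \<Rightarrow> real vec set \<Rightarrow> real vec set" where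
  "vspan k \<equiv> LinearCombinations.module.span class_ring (module_vec TYPE(real) k)"

abbreviation vindep :: "nat \<Rightarrow> real vec set \<Rightarrow> bool" where
  "vindep k S \<equiv> \<not> LinearCombinations.module.lin_dep class_ring (module_vec TYPE(real) k) S"

text \<open>A hyperplane is a pair of a charge \<open>Q\<close> (a row vector) and a constant \<open>f\<close>, standing for
  \<open>Q(\<phi>) + f = 0\<close>.\<close>

type_synonym hyperplane = "real vec \<times> complex"

definition charge_at :: "real vec \<Rightarrow> complex vec \<Rightarrow> complex" where
  "charge_at Q \<phi> = map_vec of_real Q \<bullet> \<phi>"

text \<open>The charges \<open>Q\<^sub>*\<close> of the hyperplanes through a point. Points live in \<open>(\<complex>/2\<pi>\<i>\<int>)\<^sup>k\<close>,
  so \<open>Q(\<phi>) + f\<close> only has to vanish modulo \<open>2\<pi>\<i>\<close>.\<close>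

definition charges_through :: "hyperplane set \<Rightarrow> complex vec \<Rightarrow> real vec set" where
  "charges_through H \<phi> =
     {Q. \<exists>f. \<exists>n::int. (Q, f) \<in> H \<and> charge_at Q \<phi> + f = 2 * of_real pi * \<i> * of_int n}"

definition charge_bases :: "nat \<Rightarrow> real vec set \<Rightarrow> real vec list set" where
  "charge_bases k S = {qs. length qs = k \<and> distinct qs \<and> set qs \<subseteq> S \<and> vindep k (set qs)}"

text \<open>Each class in \<open>(\<complex>/2\<pi>\<i>\<int>)\<^sup>k\<close> is represented by its element with imaginary parts
  in \<open>[0, 2\<pi>)\<close>.\<close>

definition singular_points :: "nat \<Rightarrow> hyperplane set \<Rightarrow> complex vec set" where
  "singular_points k H =
     {\<phi> \<in> carrier_vec k. (\<forall>I<k. 0 \<le> Im (\<phi> $ I) \<and> Im (\<phi> $ I) < 2 * pi) \<and>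
        charge_bases k (charges_through H \<phi>) \<noteq> {}}"

text \<open>A flag is the list \<open>[\<F>\<^sub>1, \<dots>, \<F>\<^sub>k]\<close> of its subspaces.\<close>

definition flag_of :: "nat \<Rightarrow> real vec list \<Rightarrow> real vec set list" where
  "flag_of k qs = map (\<lambda>i. vspan k (set (take (i + 1) qs))) [0..<k]"

definition flags :: "nat \<Rightarrow> real vec set \<Rightarrow> real vec set list set" where
  "flags k S = flag_of k ` charge_bases k S"

definition kappa :: "nat \<Rightarrow> real vec set \<Rightarrow> real vec set list \<Rightarrow> real vec list" where
  "kappa k S \<F> = map (\<lambda>V. finsum_vec TYPE(real) k (\<lambda>Q. Q) (S \<inter> V)) \<F>"

definition closed_cone :: "nat \<Rightarrow> real vec list \<Rightarrow> real vec set" where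
  "closed_cone k vs =
     {v \<in> carrier_vec k. \<exists>c. (\<forall>i<length vs. 0 \<le> c i) \<and>
        (\<forall>I<k. v $ I = (\<Sum>i<length vs. c i * vs ! i $ I))}"

text \<open>\<open>iter_residue k g \<delta>\<close> is \<open>Res\<^bsub>\<delta>\<^sub>k=0\<^esub> \<cdots> Res\<^bsub>\<delta>\<^sub>1=0\<^esub> g\<close> with \<open>\<delta>\<^sub>i\<close> stored at index \<open>i - 1\<close>: the
  residue in \<open>\<delta>\<^sub>1\<close> is taken first, at fixed values of the other variables. The initial
  value of \<open>\<delta>\<close> below \<open>k\<close> is irrelevant.\<close>

primrec iter_residue :: "nat \<Rightarrow> ((nat \<Rightarrow> complex) \<Rightarrow> complex) \<Rightarrow> (nat \<Rightarrow> complex) \<Rightarrow> complex" where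
  "iter_residue 0 g \<delta> = g \<delta>"
| "iter_residue (Suc i) g \<delta> = residue (\<lambda>z. iter_residue i g (\<delta>(i := z))) 0"

text \<open>The point near \<open>\<phi>\<^sub>0\<close> with \<open>Q\<^bsub>j\<^sub>i\<^esub>(\<phi>) + f\<^bsub>j\<^sub>i\<^esub> = \<delta>\<^sub>i\<close> for all \<open>i\<close>: since \<open>Q\<^bsub>j\<^sub>i\<^esub>(\<phi>\<^sub>0) + f\<^bsub>j\<^sub>i\<^esub>\<close>
  vanishes modulo \<open>2\<pi>\<i>\<close>, this condition reads \<open>Q\<^bsub>j\<^sub>i\<^esub>(\<phi> - \<phi>\<^sub>0) = \<delta>\<^sub>i\<close>.\<close>

definition point_at :: "nat \<Rightarrow> real vec list \<Rightarrow> complex vec \<Rightarrow> (nat \<Rightarrow> complex) \<Rightarrow> complex vec" where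
  "point_at k qs \<phi>\<^sub>0 \<delta> = (THE \<phi>. \<phi> \<in> carrier_vec k \<and> (\<forall>i<k. charge_at (qs ! i) (\<phi> - \<phi>\<^sub>0) = \<delta> i))"

definition flag_term ::
  "nat \<Rightarrow> real vec set \<Rightarrow> (complex vec \<Rightarrow> complex) \<Rightarrow> complex vec \<Rightarrow> real vec \<Rightarrow> real vec list \<Rightarrow> complex" where
  "flag_term k S g \<phi>\<^sub>0 \<eta> qs =
     (let \<kappa> = kappa k S (flag_of k qs) in
      if \<eta> \<in> closed_cone k \<kappa>
      then of_real (sgn (Determinant.det (mat_of_rows k \<kappa>)) / Determinant.det (mat_of_rows k qs)) *
           iter_residue k (\<lambda>\<delta>. g (point_at k qs \<phi>\<^sub>0 \<delta>)) (\<lambda>_. 0)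
      else 0)"

definition basis_choice :: "nat \<Rightarrow> hyperplane set \<Rightarrow>
    (complex vec \<Rightarrow> real vec set list \<Rightarrow> real vec list) \<Rightarrow> bool" where
  "basis_choice k H B \<longleftrightarrow>
     (\<forall>\<phi>\<in>singular_points k H. \<forall>\<F>\<in>flags k (charges_through H \<phi>).
        B \<phi> \<F> \<in> charge_bases k (charges_through H \<phi>) \<and> flag_of k (B \<phi> \<F>) = \<F>)"

definition jk_sum :: "nat \<Rightarrow> hyperplane set \<Rightarrow> (complex vec \<Rightarrow> complex) \<Rightarrow>
    (complex vec \<Rightarrow> real vec set list \<Rightarrow> real vec list) \<Rightarrow> real vec \<Rightarrow> complex" where
  "jk_sum k H g B \<eta> =
     (\<Sum>\<phi>\<in>singular_points k H. \<Sum>\<F>\<in>flags k (charges_through H \<phi>).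
        flag_term k (charges_through H \<phi>) g \<phi> \<eta> (B \<phi> \<F>))"

text \<open>A reference vector is generic if it avoids the linear spans of all faces of the cones
  that occur.\<close>

definition generic_ref :: "nat \<Rightarrow> hyperplane set \<Rightarrow> real vec \<Rightarrow> bool" where
  "generic_ref k H \<eta> \<longleftrightarrow> \<eta> \<in> carrier_vec k \<and>
     (\<forall>\<phi>\<in>singular_points k H. \<forall>\<F>\<in>flags k (charges_through H \<phi>). \<forall>i<k.
        \<eta> \<notin> vspan k {kappa k (charges_through H \<phi>) \<F> ! j | j. j < k \<and> j \<noteq> i})"

text \<open>The numbers produced by the prescription: a basis is chosen for each flag, and \<open>\<eta>\<close> is
  replaced by a generic vector \<open>\<eta>'\<close> arbitrarily close to it. If \<open>\<eta>\<close> is itself generic, the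
  cone conditions hold for \<open>\<eta>'\<close> exactly when they hold for \<open>\<eta>\<close>, so the replacement has no effect.\<close>

definition is_jk_residue ::
  "nat \<Rightarrow> hyperplane set \<Rightarrow> (complex vec \<Rightarrow> complex) \<Rightarrow> real vec \<Rightarrow> complex \<Rightarrow> bool" where
  "is_jk_residue k H g \<eta> v \<longleftrightarrow>
     (\<exists>B. basis_choice k H B \<and>
        (\<forall>r>0. \<exists>\<eta>'. generic_ref k H \<eta>' \<and> (\<forall>I<k. \<bar>\<eta>' $ I - \<eta> $ I\<bar> < r) \<and>
           v = jk_sum k H g B \<eta>'))"

text \<open>\<open>\<integral>\<^sub>\<eta> \<Prod> d\<phi>\<^sub>I/(2\<pi>\<i>) g\<close>. The prescription leaves the bases and the nearby vector
  unspecified, hence the choice operator.\<close>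

definition jk_integral ::
  "nat \<Rightarrow> hyperplane set \<Rightarrow> (complex vec \<Rightarrow> complex) \<Rightarrow> real vec \<Rightarrow> complex" where
  "jk_integral k H g \<eta> = (SOME v. is_jk_residue k H g \<eta> v)"

text \<open>One hyperplane for each denominator factor \<open>sh (Q(\<phi>) + f)\<close>, with the sign of the
  argument as displayed in the integrands.\<close>

definition D_hyperplanes :: "(nat \<Rightarrow> complex) \<Rightarrow> nat \<Rightarrow> hyperplane set" where
  "D_hyperplanes \<epsilon> k =
     {(unit_vec k I - unit_vec k J, - \<epsilon> a) | I J a. I < k \<and> J < k \<and> I \<noteq> J \<and> a \<in> {1..4}}"

definition F_hyperplanes ::
  "(nat \<Rightarrow> complex) \<Rightarrow> complex \<Rightarrow> nat list \<Rightarrow> nat list \<Rightarrow> nat list \<Rightarrow> nat \<Rightarrow> hyperplane set" where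
  "F_hyperplanes \<epsilon> \<aa> lam mu nu k =
     {(unit_vec k I, - \<aa> - content \<epsilon> b) | I b. I < k \<and> b \<in> concave_corners lam mu nu} \<union>
     {(- unit_vec k I, \<aa> + content \<epsilon> b + \<epsilon> 4) | I b m.
        I < k \<and> m \<in> {1, 2} \<and> b \<in> convex_corners lam mu nu m} \<union>
     D_hyperplanes \<epsilon> k"

definition F_conj_hyperplanes ::
  "(nat \<Rightarrow> complex) \<Rightarrow> complex \<Rightarrow> nat list \<Rightarrow> nat list \<Rightarrow> nat list \<Rightarrow> nat \<Rightarrow> hyperplane set" where
  "F_conj_hyperplanes \<epsilon> \<aa> lam mu nu k =
     {(- unit_vec k I, \<aa> - content \<epsilon> b) | I b. I < k \<and> b \<in> concave_corners lam mu nu} \<union>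
     {(unit_vec k I, - \<aa> + content \<epsilon> b + \<epsilon> 4) | I b m.
        I < k \<and> m \<in> {1, 2} \<and> b \<in> convex_corners lam mu nu m} \<union>
     D_hyperplanes \<epsilon> k"

definition PT3_prefactor :: "(nat \<Rightarrow> complex) \<Rightarrow> complex" where
  "PT3_prefactor \<epsilon> = (\<Prod>i\<in>{1..3}. sh (- \<epsilon> i - \<epsilon> 4)) / (\<Prod>a\<in>{1..4}. sh (- \<epsilon> a))"

definition PT3_coeff ::
  "(nat \<Rightarrow> complex) \<Rightarrow> complex \<Rightarrow> nat list \<Rightarrow> nat list \<Rightarrow> nat list \<Rightarrow> nat \<Rightarrow> complex" where
  "PT3_coeff \<epsilon> \<aa> lam mu nu k =
     1 / fact k * PT3_prefactor \<epsilon> ^ k *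
     jk_integral k (F_hyperplanes \<epsilon> \<aa> lam mu nu k) (integrand \<epsilon> (F_fun \<epsilon> \<aa> lam mu nu) k)
       (vec k (\<lambda>_. - 1))"

definition PT3 ::
  "(nat \<Rightarrow> complex) \<Rightarrow> complex \<Rightarrow> nat list \<Rightarrow> nat list \<Rightarrow> nat list \<Rightarrow> complex fps" where
  "PT3 \<epsilon> \<aa> lam mu nu = Abs_fps (PT3_coeff \<epsilon> \<aa> lam mu nu)"

end

theory Submission
  imports Defs "Jordan_Normal_Form.DL_Rank"
begin

text \<open>The reflection \<open>\<phi>\<^sub>I \<mapsto> 2\<aa> - \<phi>\<^sub>I\<close> turns the integrand built from \<open>F\<close> into the one built
  from its conjugate; the product of the factors \<open>D\<close> is invariant because it runs over ordered pairs.
  The reflection negates all charges, so cones and reference vectors are negated, the spans forming a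
  flag are unchanged, and both determinants acquire the sign \<open>(-1)\<^sup>k\<close>, which cancels. The
  iterated residues agree because \<open>-Q\<close> evaluated at the reflected displacement is \<open>Q\<close> evaluated at
  the original one. Representatives modulo \<open>2\<pi>\<i>\<close> do not matter: charges are integral, and
  every ratio of \<open>sh\<close> factors in the integrand is \<open>2\<pi>\<i>\<close>-periodic.\<close>

section \<open>Negating sets of vectors\<close>

lemma smult_minus_one_vec: "(- 1) \<cdot>\<^sub>v v = - (v :: real vec)"
  by (rule eq_vecI) auto

lemma vspan_uminus_subset:
  assumes "X \<subseteq> carrier_vec k"
  shows "vspan k (uminus ` X) \<subseteq> vspan k X"
proof -
  interpret vec_space "TYPE(real)" k .
  have neg: "- v \<in> span X" if "v \<in> X" for v
  proof -
    have "v \<in> span X" "v \<in> carrier_vec k"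
      using that assms in_own_span[of X] by auto
    then show ?thesis
      using smult_in_span[OF assms, of v "-1"] by (simp add: smult_minus_one_vec)
  qed
  show ?thesis
    using assms neg by (intro span_is_subset span_is_submodule) auto
qed

lemma vspan_uminus:
  assumes "X \<subseteq> carrier_vec k"
  shows "vspan k (uminus ` X) = vspan k X"
proof
  have "uminus ` uminus ` X = X"
    by (simp add: image_image)
  moreover have "uminus ` X \<subseteq> carrier_vec k"
    using assms by auto
  ultimately show "vspan k X \<subseteq> vspan k (uminus ` X)"
    using vspan_uminus_subset by metis
qed (rule vspan_uminus_subset[OF assms])

lemma uminus_in_vspan_iff:
  assumes "X \<subseteq> carrier_vec k" "v \<in> carrier_vec k"
  shows "- v \<in> vspan k X \<longleftrightarrow> v \<in> vspan k X"
proof -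
  interpret vec_space "TYPE(real)" k .
  have "- w \<in> span X" if "w \<in> span X" for w
    using that smult_in_span[OF assms(1), of w "-1"] span_is_subset2[of X] assms(1)
    by (auto simp: smult_minus_one_vec)
  from this[of v] this[of "- v"] show ?thesis by auto
qed

text \<open>A dimension count replaces any handling of linear combinations: \<open>k\<close>
  independent vectors form a basis, and their negatives span the same space with at most
  \<open>k\<close> elements, so they form a basis too.\<close>

lemma vindep_uminus:
  assumes "X \<subseteq> carrier_vec k" "finite X" "card X = k" "vindep k X"
  shows "vindep k (uminus ` X)"
proof -
  interpret vec_space "TYPE(real)" k .
  have "basis X"
    using assms by (intro dim_li_is_basis) (auto simp: dim_is_n)
  then have "span (uminus ` X) = carrier_vec k"
    using vspan_uminus[OF assms(1)] by (simp add: basis_def)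
  moreover have "card (uminus ` X) \<le> k"
    using card_image_le[OF assms(2)] assms(3) by metis
  ultimately have "basis (uminus ` X)"
    using assms by (intro dim_gen_is_basis) (auto simp: dim_is_n)
  then show ?thesis
    by (simp add: basis_def)
qed

section \<open>Charge bases and flags under negation\<close>

lemma charge_bases_uminus:
  assumes "S \<subseteq> carrier_vec k" "qs \<in> charge_bases k S"
  shows "map uminus qs \<in> charge_bases k (uminus ` S)"
proof -
  have qs: "length qs = k" "distinct qs" "set qs \<subseteq> S" "vindep k (set qs)"
    using assms(2) by (auto simp: charge_bases_def)
  have "vindep k (uminus ` set qs)"
    using qs assms(1) by (intro vindep_uminus) (auto simp: distinct_card)
  moreover have "distinct (map uminus qs)"
    using qs(2) by (auto simp: distinct_map inj_on_def)
  ultimately show ?thesis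
    using qs by (auto simp: charge_bases_def)
qed

lemma uminus_uminus_image: "uminus ` uminus ` (S :: real vec set) = S"
  by (simp add: image_image)

text \<open>Negation is an involution, so the reverse inclusion is the forward one applied to the
  negated set of charges.\<close>

lemma charge_bases_uminus_eq:
  assumes "S \<subseteq> carrier_vec k"
  shows "charge_bases k (uminus ` S) = map uminus ` charge_bases k S"
proof
  have *: "map uminus (map uminus qs) = qs" for qs :: "real vec list"
    by (simp add: map_idI)
  have "map uminus qs \<in> charge_bases k S" if "qs \<in> charge_bases k (uminus ` S)" for qs
  proof -
    have "uminus ` S \<subseteq> carrier_vec k" using assms by auto
    from charge_bases_uminus[OF this that] show ?thesis by (simp only: uminus_uminus_image)
  qed
  then show "charge_bases k (uminus ` S) \<subseteq> map uminus ` charge_bases k S"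
    using * by (metis image_eqI subsetI)
qed (use charge_bases_uminus[OF assms] in auto)

text \<open>A flag records spans only, and these ignore signs. The flags therefore agree literally,
  and one flag can index terms on both sides of the reflection.\<close>

lemma flag_of_uminus:
  assumes "set qs \<subseteq> carrier_vec k"
  shows "flag_of k (map uminus qs) = flag_of k qs"
proof -
  have "vspan k (uminus ` set (take i qs)) = vspan k (set (take i qs))" for i
    using assms by (intro vspan_uminus) (auto dest: in_set_takeD)
  then show ?thesis
    by (simp add: flag_of_def take_map)
qed

lemma flags_uminus:
  assumes "S \<subseteq> carrier_vec k"
  shows "flags k (uminus ` S) = flags k S"
proof -
  have "flag_of k (map uminus qs) = flag_of k qs" if "qs \<in> charge_bases k S" for qs
    using that assms by (intro flag_of_uminus) (auto simp: charge_bases_def)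
  then show ?thesis
    unfolding flags_def charge_bases_uminus_eq[OF assms] image_image by simp
qed

lemma flags_obtain_basis:
  assumes "S \<subseteq> carrier_vec k" "\<F> \<in> flags k S"
  obtains qs where "set qs \<subseteq> carrier_vec k" "qs \<in> charge_bases k S" "\<F> = flag_of k qs"
  using assms by (auto simp: flags_def charge_bases_def)

lemma length_flag: "\<F> \<in> flags k S \<Longrightarrow> length \<F> = k"
  by (auto simp: flags_def flag_of_def)

section \<open>Charge sums, determinants and cones under negation\<close>

lemma finsum_vec_uminus:
  assumes "A \<subseteq> carrier_vec k"
  shows "finsum_vec TYPE(real) k (\<lambda>Q. Q) (uminus ` A) = - finsum_vec TYPE(real) k (\<lambda>Q. Q) A"
proof (cases "finite A")
  \<comment> \<open>A sum over an infinite set has the default value zero, and negation keeps the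
    set infinite, so both sides vanish. This spares a finiteness proof for the sets of
    charges.\<close>
  case False
  then have "infinite (uminus ` A)"
    by (metis finite_imageI uminus_uminus_image)
  have inf: "finsum_vec TYPE(real) k (\<lambda>Q. Q) B = 0\<^sub>v k" if "infinite B" for B
    using comm_monoid.finprod_infinite[OF comm_monoid_vec that]
    by (simp add: finsum_vec_def monoid_vec_def)
  show ?thesis
    using inf False \<open>infinite (uminus ` A)\<close> by simp
next
  case True
  have A: "A \<subseteq> carrier_vec k" "uminus ` A \<subseteq> carrier_vec k"
    using assms by auto
  have c: "finsum_vec TYPE(real) k (\<lambda>Q. Q) B \<in> carrier_vec k" if "B \<subseteq> carrier_vec k" for B
    using that by (intro finsum_vec_closed) auto
  show ?thesis
  proof (rule eq_vecI)
    fix i assume "i < dim_vec (- finsum_vec TYPE(real) k (\<lambda>Q. Q) A)"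
    then have i: "i < k"
      using c[OF A(1)] by simp
    have "finsum_vec TYPE(real) k (\<lambda>Q. Q) (uminus ` A) $ i = (\<Sum>Q\<in>uminus ` A. Q $ i)"
      using True i A by (intro index_finsum_vec) auto
    also have "\<dots> = (\<Sum>Q\<in>A. (- Q) $ i)"
      by (subst sum.reindex) (auto simp: inj_on_def)
    also have "\<dots> = (\<Sum>Q\<in>A. - (Q $ i))"
      using A i by (intro sum.cong) auto
    also have "\<dots> = - (finsum_vec TYPE(real) k (\<lambda>Q. Q) A $ i)"
      using True i A by (subst index_finsum_vec) (auto simp: sum_negf)
    also have "\<dots> = (- finsum_vec TYPE(real) k (\<lambda>Q. Q) A) $ i"
      using i c[OF A(1)] by simp
    finally show "finsum_vec TYPE(real) k (\<lambda>Q. Q) (uminus ` A) $ i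
      = (- finsum_vec TYPE(real) k (\<lambda>Q. Q) A) $ i" .
  qed (use c[OF A(1)] c[OF A(2)] in simp)
qed

lemma kappa_carrier:
  assumes "S \<subseteq> carrier_vec k"
  shows "set (kappa k S \<F>) \<subseteq> carrier_vec k"
  using assms by (auto simp: kappa_def intro!: finsum_vec_closed)

text \<open>Each member of the flag is a span, hence closed under negation. Intersecting it with the
  negated charges thus gives the negatives of the original intersection, and the sum over it changes
  sign.\<close>

lemma kappa_uminus:
  assumes S: "S \<subseteq> carrier_vec k" and F: "\<F> \<in> flags k S"
  shows "kappa k (uminus ` S) \<F> = map uminus (kappa k S \<F>)"
proof -
  obtain qs where qs: "set qs \<subseteq> carrier_vec k" "\<F> = flag_of k qs"
    using flags_obtain_basis[OF S F] by metis
  have "finsum_vec TYPE(real) k (\<lambda>Q. Q) (uminus ` S \<inter> V)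
      = - finsum_vec TYPE(real) k (\<lambda>Q. Q) (S \<inter> V)" if V: "V \<in> set \<F>" for V
  proof -
    obtain i where "V = vspan k (set (take (i + 1) qs))"
      using V by (auto simp: qs(2) flag_of_def)
    then have "- v \<in> V \<longleftrightarrow> v \<in> V" if "v \<in> carrier_vec k" for v
      using that qs(1) by (simp only:) (intro uminus_in_vspan_iff, auto dest: in_set_takeD)
    then have "uminus ` S \<inter> V = uminus ` (S \<inter> V)"
      using S by auto
    then show ?thesis
      using finsum_vec_uminus[of "S \<inter> V" k] S by auto
  qed
  then show ?thesis
    by (simp add: kappa_def)
qed

text \<open>Negating all rows scales the matrix by -1, which contributes one sign per column. The
  list \<open>vs\<close> may have any length, since a nonsquare matrix has determinant 0 by
  convention.\<close>

lemma det_mat_of_rows_uminus: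
  assumes "set vs \<subseteq> carrier_vec k"
  shows "Determinant.det (mat_of_rows k (map uminus vs))
       = (- 1) ^ k * Determinant.det (mat_of_rows k vs :: real mat)"
proof -
  have "mat_of_rows k (map uminus vs) = (- 1) \<cdot>\<^sub>m mat_of_rows k vs"
  proof (rule eq_matI)
    fix i j assume "i < dim_row ((- 1) \<cdot>\<^sub>m mat_of_rows k vs)" "j < dim_col ((- 1) \<cdot>\<^sub>m mat_of_rows k vs)"
    then have ij: "i < length vs" "j < k" by auto
    then have "vs ! i \<in> carrier_vec k" using assms by auto
    then show "mat_of_rows k (map uminus vs) $$ (i, j) = ((- 1) \<cdot>\<^sub>m mat_of_rows k vs) $$ (i, j)"
      using ij by (simp add: mat_of_rows_def)
  qed auto
  then show ?thesis by simp
qed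

text \<open>The same nonnegative coefficients witness both memberships.\<close>

lemma closed_cone_uminus:
  assumes "set vs \<subseteq> carrier_vec k" "\<eta> \<in> carrier_vec k"
  shows "- \<eta> \<in> closed_cone k (map uminus vs) \<longleftrightarrow> \<eta> \<in> closed_cone k vs"
proof -
  have "(\<Sum>i<length vs. c i * (- (vs ! i)) $ I) = - (\<Sum>i<length vs. c i * vs ! i $ I)"
    if "I < k" for c I
  proof -
    have "I < dim_vec (vs ! i)" if "i < length vs" for i
      using \<open>I < k\<close> assms(1) that nth_mem by fastforce
    then show ?thesis
      by (simp add: sum_negf)
  qed
  then show ?thesis
    using assms(2) by (auto simp: closed_cone_def)
qed

section \<open>Local coordinates at a singular point\<close>

lemma charge_basis_det_nonzero:
  assumes S: "S \<subseteq> carrier_vec k" and qs: "qs \<in> charge_bases k S"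
  shows "Determinant.det (mat_of_rows k qs :: real mat) \<noteq> 0"
proof -
  interpret vec_space "TYPE(real)" k .
  \<comment> \<open>Rank is a notion about columns, so the charges are first placed as columns;
    transposition then gives the matrix of rows.\<close>
  let ?A = "mat_of_cols k qs"
  have q: "length qs = k" "distinct qs" "set qs \<subseteq> carrier_vec k" "lin_indpt (set qs)"
    using qs S by (auto simp: charge_bases_def)
  have A: "?A \<in> carrier_mat k k" using q(1) by auto
  have "cols ?A = qs" using q(3) by (rule cols_mat_of_cols)
  then have "rank ?A = k"
    using A q by (intro lin_indpt_full_rank) auto
  then have "Determinant.det ?A \<noteq> 0"
    using det_rank_iff[OF A] by simp
  moreover have "mat_of_rows k qs = transpose_mat ?A"
    using transpose_mat_of_cols by metis
  ultimately show ?thesis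
    using det_transpose[OF A] by simp
qed

lemma charge_at_eq_sum:
  assumes "Q \<in> carrier_vec k" "\<phi> \<in> carrier_vec k"
  shows "charge_at Q \<phi> = (\<Sum>I<k. of_real (Q $ I) * \<phi> $ I)"
  using assms by (auto simp: charge_at_def scalar_prod_def atLeast0LessThan intro!: sum.cong)

text \<open>This justifies the definite description in \<open>point_at\<close>: the charges of a
  basis form an invertible matrix, so a displacement is determined by its coordinates
  \<open>\<delta>\<close>.\<close>

lemma point_at_ex1:
  assumes S: "S \<subseteq> carrier_vec k" and qs: "qs \<in> charge_bases k S" and p: "\<phi>\<^sub>0 \<in> carrier_vec k"
  shows "\<exists>!\<phi>. \<phi> \<in> carrier_vec k \<and> (\<forall>i<k. charge_at (qs ! i) (\<phi> - \<phi>\<^sub>0) = \<delta> i)"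
proof -
  \<comment> \<open>Charges are real but displacements are complex. The embedding of the reals
    commutes with determinants, so invertibility carries over.\<close>
  let ?A = "map_mat complex_of_real (mat_of_rows k qs)"
  have q: "length qs = k" "set qs \<subseteq> carrier_vec k"
    using qs S by (auto simp: charge_bases_def)
  have A: "?A \<in> carrier_mat k k" using q by auto
  have "Determinant.det ?A = complex_of_real (Determinant.det (mat_of_rows k qs))"
    by (rule of_real_hom.hom_det)
  then have "Determinant.det ?A \<noteq> 0"
    using charge_basis_det_nonzero[OF S qs] by simp
  from det_non_zero_imp_unit[OF A this, unfolded Units_def, of "()"]
  obtain B where B: "B \<in> carrier_mat k k" "B * ?A = 1\<^sub>m k" "?A * B = 1\<^sub>m k"
    by (auto simp: ring_mat_def)
  have row: "charge_at (qs ! i) v = (?A *\<^sub>v v) $ i" if "i < k" "v \<in> carrier_vec k" for i v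
  proof -
    have "qs ! i \<in> carrier_vec k" using q that by auto
    then have "row ?A i = map_vec of_real (qs ! i)"
      using that q by (auto simp: mat_of_rows_def)
    then show ?thesis using that A q by (simp add: charge_at_def)
  qed
  \<comment> \<open>Solving the linear system with the inverse \<open>B\<close> gives the point
    explicitly, hence existence and uniqueness at once.\<close>
  have iff: "(\<forall>i<k. charge_at (qs ! i) (\<phi> - \<phi>\<^sub>0) = \<delta> i) \<longleftrightarrow> \<phi> = \<phi>\<^sub>0 + B *\<^sub>v vec k \<delta>"
    if c: "\<phi> \<in> carrier_vec k" for \<phi>
  proof -
    have d: "\<phi> - \<phi>\<^sub>0 \<in> carrier_vec k" using c p by auto
    have "(\<forall>i<k. charge_at (qs ! i) (\<phi> - \<phi>\<^sub>0) = \<delta> i) \<longleftrightarrow> ?A *\<^sub>v (\<phi> - \<phi>\<^sub>0) = vec k \<delta>"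
      using row d A q by (auto intro!: eq_vecI simp del: index_mult_mat_vec)
    also have "\<dots> \<longleftrightarrow> \<phi> - \<phi>\<^sub>0 = B *\<^sub>v vec k \<delta>"
    proof
      assume "?A *\<^sub>v (\<phi> - \<phi>\<^sub>0) = vec k \<delta>"
      then have "B *\<^sub>v vec k \<delta> = (B * ?A) *\<^sub>v (\<phi> - \<phi>\<^sub>0)"
        using assoc_mult_mat_vec[OF B(1) A d] by simp
      then show "\<phi> - \<phi>\<^sub>0 = B *\<^sub>v vec k \<delta>" using d B(2) by simp
    next
      assume "\<phi> - \<phi>\<^sub>0 = B *\<^sub>v vec k \<delta>"
      then have "?A *\<^sub>v (\<phi> - \<phi>\<^sub>0) = (?A * B) *\<^sub>v vec k \<delta>"
        using assoc_mult_mat_vec[OF A B(1), of "vec k \<delta>"] by simp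
      then show "?A *\<^sub>v (\<phi> - \<phi>\<^sub>0) = vec k \<delta>" using B(3) by simp
    qed
    also have "\<dots> \<longleftrightarrow> \<phi> = \<phi>\<^sub>0 + B *\<^sub>v vec k \<delta>"
    proof -
      have w: "B *\<^sub>v vec k \<delta> \<in> carrier_vec k" using B(1) by auto
      show ?thesis
        using c p w by (auto simp: vec_eq_iff algebra_simps simp del: index_mult_mat_vec)
    qed
    finally show ?thesis .
  qed
  have "\<phi>\<^sub>0 + B *\<^sub>v vec k \<delta> \<in> carrier_vec k" using p B(1) by auto
  then show ?thesis using iff by blast
qed

lemma point_at_eq:
  assumes "S \<subseteq> carrier_vec k" "qs \<in> charge_bases k S" "\<phi>\<^sub>0 \<in> carrier_vec k"
    and "\<phi> \<in> carrier_vec k" "\<And>i. i < k \<Longrightarrow> charge_at (qs ! i) (\<phi> - \<phi>\<^sub>0) = \<delta> i"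
  shows "point_at k qs \<phi>\<^sub>0 \<delta> = \<phi>"
  unfolding point_at_def using assms by (intro the1_equality point_at_ex1) auto

lemma point_at_props:
  assumes "S \<subseteq> carrier_vec k" "qs \<in> charge_bases k S" "\<phi>\<^sub>0 \<in> carrier_vec k"
  shows "point_at k qs \<phi>\<^sub>0 \<delta> \<in> carrier_vec k"
    and "i < k \<Longrightarrow> charge_at (qs ! i) (point_at k qs \<phi>\<^sub>0 \<delta> - \<phi>\<^sub>0) = \<delta> i"
  using theI'[OF point_at_ex1[OF assms, of \<delta>]] unfolding point_at_def by auto

text \<open>Negating both the charge and the displacement leaves their pairing unchanged, so the
  coordinates \<open>\<delta>\<close> are the same at both points. The base points may be arbitrary
  because only displacements enter.\<close>

lemma point_at_uminus:
  assumes S: "S \<subseteq> carrier_vec k" and qs: "qs \<in> charge_bases k S"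
    and p: "\<phi>\<^sub>0 \<in> carrier_vec k" "\<phi>\<^sub>1 \<in> carrier_vec k"
  shows "point_at k (map uminus qs) \<phi>\<^sub>1 \<delta> = \<phi>\<^sub>1 + (\<phi>\<^sub>0 - point_at k qs \<phi>\<^sub>0 \<delta>)"
proof (rule point_at_eq)
  show "uminus ` S \<subseteq> carrier_vec k" using S by auto
  show "map uminus qs \<in> charge_bases k (uminus ` S)" using S qs by (rule charge_bases_uminus)
  note pt = point_at_props(1)[OF S qs p(1), of \<delta>] point_at_props(2)[OF S qs p(1), of _ \<delta>]
  let ?p = "point_at k qs \<phi>\<^sub>0 \<delta>"
  show "\<phi>\<^sub>1 + (\<phi>\<^sub>0 - ?p) \<in> carrier_vec k" using pt(1) p by auto
  fix i assume i: "i < k"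
  have len: "length qs = k" and q: "qs ! i \<in> carrier_vec k"
    using qs S i by (auto simp: charge_bases_def subset_iff)
  have "charge_at (- (qs ! i)) (\<phi>\<^sub>1 + (\<phi>\<^sub>0 - ?p) - \<phi>\<^sub>1) = charge_at (qs ! i) (?p - \<phi>\<^sub>0)"
    using q p pt(1) by (auto simp: charge_at_eq_sum[of _ k] algebra_simps intro!: sum.cong)
  then show "charge_at (map uminus qs ! i) (\<phi>\<^sub>1 + (\<phi>\<^sub>0 - ?p) - \<phi>\<^sub>1) = \<delta> i"
    using pt(2)[OF i] i len by simp
qed (use p in auto)

section \<open>Reflecting the integration variables\<close>

text \<open>The representative modulo \<open>2 * pi * \<i>\<close> whose imaginary part lies in the
  half-open strip used by \<open>singular_points\<close>.\<close>

definition reduce_2pi :: "complex \<Rightarrow> complex" where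
  "reduce_2pi z = z - 2 * of_real pi * \<i> * of_int \<lfloor>Im z / (2 * pi)\<rfloor>"

lemma reduce_2pi_shift: "\<exists>n::int. reduce_2pi z = z + 2 * of_real pi * \<i> * of_int n"
  by (rule exI[of _ "- \<lfloor>Im z / (2 * pi)\<rfloor>"]) (simp add: reduce_2pi_def)

lemma reduce_2pi_add: "reduce_2pi (z + 2 * of_real pi * \<i> * of_int n) = reduce_2pi z"
proof -
  have "Im (z + 2 * of_real pi * \<i> * of_int n) / (2 * pi) = Im z / (2 * pi) + of_int n"
    by (simp add: field_simps)
  then have "\<lfloor>Im (z + 2 * of_real pi * \<i> * of_int n) / (2 * pi)\<rfloor> = \<lfloor>Im z / (2 * pi)\<rfloor> + n"
    by (metis floor_add_int)
  then show ?thesis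
    by (simp add: reduce_2pi_def algebra_simps)
qed

lemma Im_reduce_2pi: "0 \<le> Im (reduce_2pi z)" "Im (reduce_2pi z) < 2 * pi"
proof -
  define x where "x = Im z / (2 * pi)"
  have "Im (reduce_2pi z) = 2 * pi * (x - of_int \<lfloor>x\<rfloor>)"
    by (simp add: reduce_2pi_def x_def algebra_simps)
  moreover have "0 \<le> x - of_int \<lfloor>x\<rfloor>" "x - of_int \<lfloor>x\<rfloor> < 1"
    using floor_correct[of x] by linarith+
  ultimately show "0 \<le> Im (reduce_2pi z)" "Im (reduce_2pi z) < 2 * pi"
    by simp_all
qed

lemma reduce_2pi_id:
  assumes "0 \<le> Im z" "Im z < 2 * pi"
  shows "reduce_2pi z = z"
proof -
  have "\<lfloor>Im z / (2 * pi)\<rfloor> = 0"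
    using assms by (simp add: floor_eq_iff)
  then show ?thesis by (simp add: reduce_2pi_def)
qed

text \<open>The inner reduction changes its argument by whole periods only, and the outer reduction
  absorbs them. This makes the reduced reflection an involution on representatives.\<close>

lemma reduce_2pi_reflect: "reduce_2pi (c - reduce_2pi (c - z)) = reduce_2pi z"
proof -
  obtain n :: int where "reduce_2pi (c - z) = c - z + 2 * of_real pi * \<i> * of_int n"
    using reduce_2pi_shift by blast
  then have "c - reduce_2pi (c - z) = z + 2 * of_real pi * \<i> * of_int (- n)"
    by simp
  then show ?thesis by (metis reduce_2pi_add)
qed

text \<open>The affine form of a hyperplane in \<open>H'\<close> at \<open>\<phi>\<close> is the
  form of its partner in \<open>H\<close> at the point with coordinates
  \<open>c - \<phi> $ I\<close>; this explains the added constant. Integral charges and a periodic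
  \<open>g\<close> allow that point to be moved back into the strip of representatives.\<close>

locale reflected_jk =
  fixes k :: nat and c :: complex and H H' :: "hyperplane set"
    and g g' :: "complex vec \<Rightarrow> complex"
  assumes charge_carrier: "(Q, f) \<in> H \<Longrightarrow> Q \<in> carrier_vec k"
    and charge_Ints: "(Q, f) \<in> H \<Longrightarrow> I < k \<Longrightarrow> Q $ I \<in> \<int>"
    and H'_eq: "H' = (\<lambda>(Q, f). (- Q, f + charge_at Q (vec k (\<lambda>_. c)))) ` H"
    and g'_eq: "\<phi> \<in> carrier_vec k \<Longrightarrow> g' \<phi> = g (vec k (\<lambda>I. c - \<phi> $ I))"
    and g_periodic: "\<phi> \<in> carrier_vec k \<Longrightarrow>
      g (vec k (\<lambda>I. \<phi> $ I + 2 * of_real pi * \<i> * of_int (n I))) = g \<phi>"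
begin

section \<open>Singular points and charges under the reflection\<close>

definition reflect :: "complex vec \<Rightarrow> complex vec" where
  "reflect \<phi> = vec k (\<lambda>I. reduce_2pi (c - \<phi> $ I))"

lemma reflect_carrier [simp]: "reflect \<phi> \<in> carrier_vec k"
  by (simp add: reflect_def)

lemma reflect_shift:
  obtains n :: "nat \<Rightarrow> int"
  where "\<And>I. I < k \<Longrightarrow> reflect \<phi> $ I = c - \<phi> $ I + 2 * of_real pi * \<i> * of_int (n I)"
proof -
  have "\<forall>I. \<exists>n::int. reduce_2pi (c - \<phi> $ I) = c - \<phi> $ I + 2 * of_real pi * \<i> * of_int n"
    using reduce_2pi_shift by blast
  then obtain n :: "nat \<Rightarrow> int"
    where "\<forall>I. reduce_2pi (c - \<phi> $ I) = c - \<phi> $ I + 2 * of_real pi * \<i> * of_int (n I)"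
    by metis
  then show thesis by (intro that[of n]) (simp add: reflect_def)
qed

lemma reflect_reflect:
  assumes "\<phi> \<in> singular_points k H"
  shows "reflect (reflect \<phi>) = \<phi>"
  using assms
  by (intro eq_vecI) (auto simp: reflect_def singular_points_def reduce_2pi_reflect reduce_2pi_id)

lemma charges_through_carrier: "charges_through H \<phi> \<subseteq> carrier_vec k"
  using charge_carrier by (auto simp: charges_through_def)

text \<open>Reducing the coordinates adds periods, which an integral charge turns into an integer
  multiple of one period.\<close>

lemma charge_at_reflect:
  assumes Q: "(Q, f) \<in> H" and p: "\<phi> \<in> carrier_vec k"
  shows "\<exists>m::int. charge_at (- Q) (reflect \<phi>) + (f + charge_at Q (vec k (\<lambda>_. c)))
    = charge_at Q \<phi> + f + 2 * of_real pi * \<i> * of_int m"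
proof -
  have Qc: "Q \<in> carrier_vec k" using Q by (rule charge_carrier)
  obtain n :: "nat \<Rightarrow> int"
    where n: "\<And>I. I < k \<Longrightarrow> reflect \<phi> $ I = c - \<phi> $ I + 2 * of_real pi * \<i> * of_int (n I)"
    using reflect_shift[of \<phi>] by blast
  have "(\<Sum>I<k. Q $ I * of_int (n I)) \<in> \<int>"
    using charge_Ints[OF Q] by (intro Ints_sum Ints_mult) auto
  then obtain m :: int where m: "(\<Sum>I<k. Q $ I * of_int (n I)) = of_int m"
    by (rule Ints_cases)
  have "charge_at (- Q) (reflect \<phi>)
      = (\<Sum>I<k. - (of_real (Q $ I) * c) + of_real (Q $ I) * \<phi> $ I
          - 2 * of_real pi * \<i> * of_real (Q $ I * of_int (n I)))"
    using Qc by (auto simp: charge_at_eq_sum[of _ k] n algebra_simps intro!: sum.cong)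
  also have "\<dots> = - charge_at Q (vec k (\<lambda>_. c)) + charge_at Q \<phi>
      - 2 * of_real pi * \<i> * of_real (\<Sum>I<k. Q $ I * of_int (n I))"
    using Qc p
    by (simp add: charge_at_eq_sum[of _ k] sum.distrib sum_subtractf sum_negf sum_distrib_left)
  finally show ?thesis
    unfolding m by (intro exI[of _ "- m"]) simp
qed

text \<open>Incidence is tested modulo \<open>2 * pi * \<i>\<close>, so the extra multiple from
  \<open>charge_at_reflect\<close> is absorbed by the existential integer.\<close>

lemma charges_through_reflect:
  assumes p: "\<phi> \<in> carrier_vec k"
  shows "charges_through H' (reflect \<phi>) = uminus ` charges_through H \<phi>"
proof -
  have iff: "(\<exists>n::int. charge_at (- Q) (reflect \<phi>) + (f + charge_at Q (vec k (\<lambda>_. c)))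
        = 2 * of_real pi * \<i> * of_int n)
      \<longleftrightarrow> (\<exists>n::int. charge_at Q \<phi> + f = 2 * of_real pi * \<i> * of_int n)"
    if Q: "(Q, f) \<in> H" for Q f
  proof -
    obtain m :: int where m: "charge_at (- Q) (reflect \<phi>) + (f + charge_at Q (vec k (\<lambda>_. c)))
        = charge_at Q \<phi> + f + 2 * of_real pi * \<i> * of_int m"
      using charge_at_reflect[OF Q p] by blast
    have "(\<exists>n::int. x + 2 * of_real pi * \<i> * of_int m = 2 * of_real pi * \<i> * of_int n)
        \<longleftrightarrow> (\<exists>n::int. x = 2 * of_real pi * \<i> * of_int n)" for x :: complex
    proof
      assume "\<exists>n::int. x + 2 * of_real pi * \<i> * of_int m = 2 * of_real pi * \<i> * of_int n"
      then obtain n :: int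
        where "x + 2 * of_real pi * \<i> * of_int m = 2 * of_real pi * \<i> * of_int n" by blast
      then have "x = 2 * of_real pi * \<i> * of_int (n - m)"
        by (simp add: algebra_simps)
      then show "\<exists>n::int. x = 2 * of_real pi * \<i> * of_int n" by blast
    next
      assume "\<exists>n::int. x = 2 * of_real pi * \<i> * of_int n"
      then obtain n :: int where "x = 2 * of_real pi * \<i> * of_int n" by blast
      then have "x + 2 * of_real pi * \<i> * of_int m = 2 * of_real pi * \<i> * of_int (n + m)"
        by (simp add: algebra_simps)
      then show "\<exists>n::int. x + 2 * of_real pi * \<i> * of_int m = 2 * of_real pi * \<i> * of_int n"
        by blast
    qed
    then show ?thesis unfolding m .
  qed
  have "charges_through H' (reflect \<phi>)
      = {- Q | Q f. (Q, f) \<in> H \<and> (\<exists>n::int.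
          charge_at (- Q) (reflect \<phi>) + (f + charge_at Q (vec k (\<lambda>_. c)))
            = 2 * of_real pi * \<i> * of_int n)}"
    unfolding charges_through_def H'_eq by force
  also have "\<dots> = {- Q | Q f. (Q, f) \<in> H \<and> (\<exists>n::int.
          charge_at Q \<phi> + f = 2 * of_real pi * \<i> * of_int n)}"
    using iff by blast
  also have "\<dots> = uminus ` charges_through H \<phi>"
    by (auto simp: charges_through_def)
  finally show ?thesis .
qed

text \<open>The situation is symmetric because the reflection is an involution. Every one-sided
  result of the locale thereby also yields its converse.\<close>

lemma reflected: "reflected_jk k c H' H g' g"
proof
  fix Q f assume "(Q, f) \<in> H'"
  then obtain P h where P: "(P, h) \<in> H" "Q = - P" by (auto simp: H'_eq)
  then show "Q \<in> carrier_vec k" using charge_carrier by auto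
  fix I assume "I < k"
  then show "Q $ I \<in> \<int>"
    using P charge_carrier[OF P(1)] charge_Ints[OF P(1)] by auto
next
  \<comment> \<open>By oddness in the charge, the constants added by two successive reflections
    cancel.\<close>
  have "charge_at (- Q) v = - charge_at Q v" if "(Q, f) \<in> H" "v \<in> carrier_vec k" for Q f v
    using charge_carrier[OF that(1)] that(2) by (simp add: charge_at_eq_sum[of _ k] sum_negf)
  then have "(\<lambda>(Q, f). (- Q, f + charge_at Q (vec k (\<lambda>_. c)))) ` H' = (\<lambda>x. x) ` H"
    unfolding H'_eq image_image by (intro image_cong) auto
  then show "H = (\<lambda>(Q, f). (- Q, f + charge_at Q (vec k (\<lambda>_. c)))) ` H'"
    by simp
next
  fix \<phi> :: "complex vec" assume p: "\<phi> \<in> carrier_vec k"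
  have "vec k (\<lambda>I. c - vec k (\<lambda>I. c - \<phi> $ I) $ I) = \<phi>"
    using p by (intro eq_vecI) auto
  then show "g \<phi> = g' (vec k (\<lambda>I. c - \<phi> $ I))"
    by (simp add: g'_eq)
  fix n :: "nat \<Rightarrow> int"
  let ?\<psi> = "vec k (\<lambda>I. \<phi> $ I + 2 * of_real pi * \<i> * of_int (n I))"
  \<comment> \<open>A shift by \<open>n I\<close> periods becomes a shift by \<open>- n I\<close>
    periods after reflection.\<close>
  have "vec k (\<lambda>I. c - ?\<psi> $ I)
      = vec k (\<lambda>I. vec k (\<lambda>I. c - \<phi> $ I) $ I + 2 * of_real pi * \<i> * of_int (- n I))"
    by (intro eq_vecI) auto
  then show "g' ?\<psi> = g' \<phi>"
    using g_periodic[of "vec k (\<lambda>I. c - \<phi> $ I)" "\<lambda>I. - n I"] p by (simp add: g'_eq)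
qed

lemma reflect_singular:
  assumes "\<phi> \<in> singular_points k H"
  shows "reflect \<phi> \<in> singular_points k H'"
proof -
  have "\<phi> \<in> carrier_vec k" "charge_bases k (charges_through H \<phi>) \<noteq> {}"
    using assms by (auto simp: singular_points_def)
  then have "charge_bases k (charges_through H' (reflect \<phi>)) \<noteq> {}"
    by (simp add: charges_through_reflect charge_bases_uminus_eq[OF charges_through_carrier])
  then show ?thesis
    by (auto simp: singular_points_def) (auto simp: reflect_def Im_reduce_2pi)
qed

lemma bij_reflect: "bij_betw reflect (singular_points k H) (singular_points k H')"
proof -
  \<comment> \<open>The map \<open>reflect\<close> depends on \<open>k\<close> and \<open>c\<close>
    only, so the exchanged interpretation has the same map, which is its own inverse.\<close>
  interpret R: reflected_jk k c H' H g' g by (rule reflected)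
  show ?thesis
    using reflect_reflect reflect_singular R.reflect_reflect R.reflect_singular
    by (intro bij_betw_byWitness[where f' = reflect]) auto
qed

text \<open>Up to periods the argument on the left has coordinates \<open>c - p $ I\<close>;
  reflecting it gives back \<open>p\<close>.\<close>

lemma integrand_reflect:
  assumes "\<phi> \<in> carrier_vec k" "p \<in> carrier_vec k"
  shows "g' (reflect \<phi> + (\<phi> - p)) = g p"
proof -
  obtain n :: "nat \<Rightarrow> int"
    where n: "\<And>I. I < k \<Longrightarrow> reflect \<phi> $ I = c - \<phi> $ I + 2 * of_real pi * \<i> * of_int (n I)"
    using reflect_shift[of \<phi>] by blast
  have "vec k (\<lambda>I. c - (reflect \<phi> + (\<phi> - p)) $ I)
      = vec k (\<lambda>I. p $ I + 2 * of_real pi * \<i> * of_int (- n I))"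
    using assms n by (intro eq_vecI) auto
  then show ?thesis
    using assms g_periodic[of p "\<lambda>I. - n I"] by (simp add: g'_eq)
qed

section \<open>Residue terms, generic reference vectors and the full sum\<close>

lemma flag_term_reflect:
  assumes p: "\<phi> \<in> carrier_vec k" and e: "\<eta> \<in> carrier_vec k"
    and qs: "qs \<in> charge_bases k (charges_through H \<phi>)"
  shows "flag_term k (charges_through H' (reflect \<phi>)) g' (reflect \<phi>) (- \<eta>) (map uminus qs)
       = flag_term k (charges_through H \<phi>) g \<phi> \<eta> qs"
proof -
  let ?S = "charges_through H \<phi>"
  note S = charges_through_carrier[of \<phi>]
  have q: "set qs \<subseteq> carrier_vec k" using qs S by (auto simp: charge_bases_def)
  have F: "flag_of k qs \<in> flags k ?S" using qs by (simp add: flags_def)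
  let ?\<kappa> = "kappa k ?S (flag_of k qs)"
  have \<kappa>: "set ?\<kappa> \<subseteq> carrier_vec k" by (rule kappa_carrier[OF S])
  have k': "kappa k (uminus ` ?S) (flag_of k (map uminus qs)) = map uminus ?\<kappa>"
    using kappa_uminus[OF S F] flag_of_uminus[OF q] by simp
  \<comment> \<open>Numerator and denominator both acquire the sign of \<open>(- 1) ^ k\<close>,
    whence the split on the parity of \<open>k\<close>.\<close>
  have "sgn (Determinant.det (mat_of_rows k (map uminus ?\<kappa>)))
        / Determinant.det (mat_of_rows k (map uminus qs))
      = sgn (Determinant.det (mat_of_rows k ?\<kappa>)) / Determinant.det (mat_of_rows k qs)"
    unfolding det_mat_of_rows_uminus[OF \<kappa>] det_mat_of_rows_uminus[OF q]
    by (cases "even k") (auto simp: sgn_minus)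
  \<comment> \<open>The integrands agree as functions of \<open>\<delta>\<close> before any residue
    is taken, so the iterated residues are literally equal.\<close>
  moreover have "g' (point_at k (map uminus qs) (reflect \<phi>) \<delta>) = g (point_at k qs \<phi> \<delta>)" for \<delta>
    using point_at_uminus[OF S qs p, of "reflect \<phi>" \<delta>] point_at_props(1)[OF S qs p, of \<delta>]
      integrand_reflect[OF p] by simp
  ultimately show ?thesis
    unfolding flag_term_def charges_through_reflect[OF p] Let_def k' closed_cone_uminus[OF \<kappa> e]
    by simp
qed

text \<open>Genericity only excludes the reference vector from certain spans, and these are
  unaffected by negating the generators or the vector tested.\<close>

lemma generic_ref_reflect:
  assumes "generic_ref k H \<eta>"
  shows "generic_ref k H' (- \<eta>)"
  unfolding generic_ref_def
proof (intro conjI ballI allI impI)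
  have e: "\<eta> \<in> carrier_vec k" using assms by (simp add: generic_ref_def)
  then show "- \<eta> \<in> carrier_vec k" by simp
  fix \<phi>' \<F> i
  assume p': "\<phi>' \<in> singular_points k H'" and F': "\<F> \<in> flags k (charges_through H' \<phi>')" and i: "i < k"
  obtain \<phi> where \<phi>: "\<phi> \<in> singular_points k H" "\<phi>' = reflect \<phi>"
    using p' bij_reflect by (auto simp: bij_betw_def)
  have p: "\<phi> \<in> carrier_vec k" using \<phi>(1) by (simp add: singular_points_def)
  note S = charges_through_carrier[of \<phi>]
  let ?\<kappa> = "kappa k (charges_through H \<phi>) \<F>"
  have F: "\<F> \<in> flags k (charges_through H \<phi>)"
    using F' by (simp add: \<phi>(2) charges_through_reflect[OF p] flags_uminus[OF S])
  have len: "length ?\<kappa> = k" using length_flag[OF F] by (simp add: kappa_def)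
  let ?X = "{?\<kappa> ! j | j. j < k \<and> j \<noteq> i}"
  have X: "?X \<subseteq> carrier_vec k" using kappa_carrier[OF S, of \<F>] len by auto
  have "{kappa k (charges_through H' \<phi>') \<F> ! j | j. j < k \<and> j \<noteq> i} = uminus ` ?X"
  proof -
    have "kappa k (charges_through H' \<phi>') \<F> ! j = - (?\<kappa> ! j)" if "j < k" for j
      using that len by (simp add: \<phi>(2) charges_through_reflect[OF p] kappa_uminus[OF S F])
    then show ?thesis by (auto simp: image_iff) metis+
  qed
  moreover have "\<eta> \<notin> vspan k ?X"
    using assms \<phi>(1) F i unfolding generic_ref_def by blast
  ultimately show "- \<eta> \<notin> vspan k {kappa k (charges_through H' \<phi>') \<F> ! j | j. j < k \<and> j \<noteq> i}"
    using vspan_uminus[OF X] uminus_in_vspan_iff[OF X e] by simp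
qed

text \<open>All choices hidden in the prescription are transported: the bases are negated, and so
  are the nearby generic vectors.\<close>

lemma is_jk_residue_reflect:
  assumes e: "\<eta> \<in> carrier_vec k" and res: "is_jk_residue k H g \<eta> v"
  shows "is_jk_residue k H' g' (- \<eta>) v"
proof -
  obtain B where B: "basis_choice k H B"
    and near: "\<And>r. r > 0 \<Longrightarrow> \<exists>\<eta>'. generic_ref k H \<eta>' \<and> (\<forall>I<k. \<bar>\<eta>' $ I - \<eta> $ I\<bar> < r) \<and>
           v = jk_sum k H g B \<eta>'"
    using res unfolding is_jk_residue_def by blast
  \<comment> \<open>A singular point of \<open>H'\<close> is sent back to one of \<open>H\<close>,
    where \<open>B\<close> already has a basis for the same flag; that basis is then
    negated.\<close>
  define B' where "B' = (\<lambda>\<phi> \<F>. map uminus (B (reflect \<phi>) \<F>))"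
  have B'_reflect: "B' (reflect \<phi>) \<F> = map uminus (B \<phi> \<F>)" if "\<phi> \<in> singular_points k H" for \<phi> \<F>
    using reflect_reflect[OF that] by (simp add: B'_def)
  have carrier: "\<phi> \<in> carrier_vec k" if "\<phi> \<in> singular_points k H" for \<phi>
    using that by (simp add: singular_points_def)
  have flags': "flags k (charges_through H' (reflect \<phi>)) = flags k (charges_through H \<phi>)"
    if "\<phi> \<in> singular_points k H" for \<phi>
    using carrier[OF that] by (simp add: charges_through_reflect flags_uminus[OF charges_through_carrier])
  have basis: "B \<phi> \<F> \<in> charge_bases k (charges_through H \<phi>)" "flag_of k (B \<phi> \<F>) = \<F>"
    if "\<phi> \<in> singular_points k H" "\<F> \<in> flags k (charges_through H \<phi>)" for \<phi> \<F>
    using B that by (auto simp: basis_choice_def)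
  have "basis_choice k H' B'"
    unfolding basis_choice_def
  proof (intro ballI)
    fix \<phi>' \<F> assume p': "\<phi>' \<in> singular_points k H'" and F': "\<F> \<in> flags k (charges_through H' \<phi>')"
    obtain \<phi> where \<phi>: "\<phi> \<in> singular_points k H" "\<phi>' = reflect \<phi>"
      using p' bij_reflect by (auto simp: bij_betw_def)
    note S = charges_through_carrier[of \<phi>]
    have F: "\<F> \<in> flags k (charges_through H \<phi>)" using F' flags'[OF \<phi>(1)] \<phi>(2) by simp
    note b = basis[OF \<phi>(1) F]
    have "set (B \<phi> \<F>) \<subseteq> carrier_vec k" using b(1) S by (auto simp: charge_bases_def)
    then show "B' \<phi>' \<F> \<in> charge_bases k (charges_through H' \<phi>') \<and> flag_of k (B' \<phi>' \<F>) = \<F>"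
      using b charge_bases_uminus[OF S b(1)] carrier[OF \<phi>(1)]
      by (simp add: \<phi> B'_reflect charges_through_reflect flag_of_uminus)
  qed
  moreover have jk: "jk_sum k H' g' B' (- \<eta>') = jk_sum k H g B \<eta>'" if "\<eta>' \<in> carrier_vec k" for \<eta>'
  proof -
    have "jk_sum k H' g' B' (- \<eta>')
        = (\<Sum>\<phi>\<in>singular_points k H. \<Sum>\<F>\<in>flags k (charges_through H' (reflect \<phi>)).
            flag_term k (charges_through H' (reflect \<phi>)) g' (reflect \<phi>) (- \<eta>') (B' (reflect \<phi>) \<F>))"
      unfolding jk_sum_def by (rule sum.reindex_bij_betw[OF bij_reflect, symmetric])
    also have "\<dots> = jk_sum k H g B \<eta>'"
      unfolding jk_sum_def using flags' basis carrier that
      by (intro sum.cong) (auto simp: B'_reflect flag_term_reflect)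
    finally show ?thesis .
  qed
  \<comment> \<open>Negation preserves coordinatewise distances, so the same radius works.\<close>
  moreover have "\<exists>\<eta>'. generic_ref k H' \<eta>' \<and> (\<forall>I<k. \<bar>\<eta>' $ I - (- \<eta>) $ I\<bar> < r) \<and>
           v = jk_sum k H' g' B' \<eta>'" if r: "r > 0" for r :: real
  proof -
    obtain \<eta>' :: "real vec" where \<eta>': "generic_ref k H \<eta>'" "\<forall>I<k. \<bar>\<eta>' $ I - \<eta> $ I\<bar> < r" "v = jk_sum k H g B \<eta>'"
      using near[OF r] by blast
    have c: "\<eta>' \<in> carrier_vec k" using \<eta>'(1) by (simp add: generic_ref_def)
    have "\<bar>(- \<eta>') $ I - (- \<eta>) $ I\<bar> < r" if "I < k" for I
    proof -
      have "(- \<eta>') $ I - (- \<eta>) $ I = - (\<eta>' $ I - \<eta> $ I)"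
        using that c e by simp
      then show ?thesis using \<eta>'(2) that by (simp only: abs_minus_cancel)
    qed
    then show ?thesis
      using generic_ref_reflect[OF \<eta>'(1)] jk[OF c] \<eta>'(3) by metis
  qed
  ultimately show ?thesis
    unfolding is_jk_residue_def by blast
qed

lemma jk_integral_reflect:
  assumes e: "\<eta> \<in> carrier_vec k"
  shows "jk_integral k H' g' (- \<eta>) = jk_integral k H g \<eta>"
proof -
  interpret R: reflected_jk k c H' H g' g by (rule reflected)
  have "is_jk_residue k H' g' (- \<eta>) v \<longleftrightarrow> is_jk_residue k H g \<eta> v" for v
    using is_jk_residue_reflect[OF e, of v] R.is_jk_residue_reflect[of "- \<eta>" v] e by auto
  \<comment> \<open>Both choices range over the same predicate, so nothing has to be known about its uniqueness.\<close>
  then show ?thesis by (simp add: jk_integral_def)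
qed

end

section \<open>The PT3 integrands\<close>

text \<open>Halving the argument makes \<open>sh\<close> periodic only up to sign. Both exponentials
  pick up the same sign, since \<open>(- 1) powi n\<close> is even in \<open>n\<close>.\<close>

lemma sh_add_2pi: "sh (x + 2 * of_real pi * \<i> * of_int n) = (- 1) powi n * sh x"
proof -
  have "exp (of_real pi * \<i> * of_int n) = (- 1 :: complex) powi n" for n :: int
    using exp_power_int[of "of_real pi * \<i>" n] by (simp add: mult_ac)
  moreover have "(- 1 :: complex) powi (- n) = (- 1) powi n"
    by (simp add: power_int_minus_one_minus)
  moreover have "exp ((x + 2 * of_real pi * \<i> * of_int n) / 2)
      = exp (x / 2) * exp (of_real pi * \<i> * of_int n)"
    by (simp add: exp_add[symmetric] field_simps)
  moreover have "exp (- (x + 2 * of_real pi * \<i> * of_int n) / 2)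
      = exp (- x / 2) * exp (of_real pi * \<i> * of_int (- n))"
    by (simp add: exp_add[symmetric] field_simps)
  ultimately show ?thesis
    by (simp only: sh_def) (simp add: algebra_simps)
qed

lemma sh_ratio_add_2pi:
  "sh (x + 2 * of_real pi * \<i> * of_int n) / sh (y + 2 * of_real pi * \<i> * of_int n) = sh x / sh y"
  by (simp add: sh_add_2pi)

lemma sh_ratio_diff_2pi:
  "sh (x - 2 * of_real pi * \<i> * of_int n) / sh (y - 2 * of_real pi * \<i> * of_int n) = sh x / sh y"
  using sh_ratio_add_2pi[of x "- n" y] by simp

lemma F_fun_add_2pi:
  "F_fun \<epsilon> \<aa> lam mu nu (\<phi> + 2 * of_real pi * \<i> * of_int n) = F_fun \<epsilon> \<aa> lam mu nu \<phi>"
proof -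
  let ?t = "2 * of_real pi * \<i> * of_int n :: complex"
  have "sh (\<phi> + ?t - u - v - w) / sh (\<phi> + ?t - u - v) = sh (\<phi> - u - v - w) / sh (\<phi> - u - v)"
    for u v w
    using sh_ratio_add_2pi[of "\<phi> - u - v - w" n "\<phi> - u - v"] by (simp add: algebra_simps)
  moreover have "sh (u + v - (\<phi> + ?t)) / sh (u + v + w - (\<phi> + ?t))
      = sh (u + v - \<phi>) / sh (u + v + w - \<phi>)" for u v w
    using sh_ratio_diff_2pi[of "u + v - \<phi>" n "u + v + w - \<phi>"] by (simp add: algebra_simps)
  ultimately show ?thesis
    by (simp only: F_fun_def)
qed

text \<open>Numerator and denominator each contain four \<open>sh\<close> factors, so the four signs
  from each side cancel.\<close>

lemma D_fun_add_2pi: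
  "D_fun \<epsilon> (\<phi> + 2 * of_real pi * \<i> * of_int n) = D_fun \<epsilon> \<phi>"
proof -
  let ?t = "2 * of_real pi * \<i> * of_int n :: complex"
  let ?s = "(- 1 :: complex) powi n"
  have 1: "sh (\<phi> + ?t - u) = ?s * sh (\<phi> - u)" for u
    using sh_add_2pi[of "\<phi> - u" n] by (simp add: algebra_simps)
  have 2: "sh (\<phi> + ?t - u - w) = ?s * sh (\<phi> - u - w)" for u w
    using sh_add_2pi[of "\<phi> - u - w" n] by (simp add: algebra_simps)
  have "?s * x * (?s ^ 3 * y) / (?s ^ 4 * z) = x * y / z" for x y z
    by (simp add: power_Suc numeral_eq_Suc mult_ac)
  then show ?thesis
    unfolding D_fun_def 1 2 sh_add_2pi by (simp add: prod.distrib)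
qed

lemma integrand_periodic:
  assumes "\<phi> \<in> carrier_vec k"
    and f: "\<And>x n. f (x + 2 * of_real pi * \<i> * of_int n) = f x"
  shows "integrand \<epsilon> f k (vec k (\<lambda>I. \<phi> $ I + 2 * of_real pi * \<i> * of_int (n I)))
       = integrand \<epsilon> f k \<phi>"
proof -
  have "D_fun \<epsilon> (\<phi> $ I + 2 * of_real pi * \<i> * of_int (n I)
      - (\<phi> $ J + 2 * of_real pi * \<i> * of_int (n J))) = D_fun \<epsilon> (\<phi> $ I - \<phi> $ J)" for I J
    using D_fun_add_2pi[of \<epsilon> "\<phi> $ I - \<phi> $ J" "n I - n J"] by (simp add: algebra_simps)
  then show ?thesis
    unfolding integrand_def
    by (intro arg_cong2[where f = "(*)"] prod.cong) (auto simp: f)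
qed

section \<open>The conjugate integrand as a reflected integrand\<close>

lemma F_conj_fun_eq: "F_conj_fun \<epsilon> \<aa> lam mu nu \<phi> = F_fun \<epsilon> \<aa> lam mu nu (2 * \<aa> - \<phi>)"
proof -
  \<comment> \<open>With center constant \<open>2 * \<aa>\<close> the arguments match factor by
    factor, without moving any sign through \<open>sh\<close>.\<close>
  have "2 * \<aa> - \<phi> - \<aa> - u = \<aa> - u - \<phi>" "\<aa> - u - w - \<phi> = \<aa> - u - \<phi> - w"
    "\<aa> + u - (2 * \<aa> - \<phi>) = \<phi> - \<aa> + u" "\<aa> + u + w - (2 * \<aa> - \<phi>) = \<phi> - \<aa> + u + w" for u w
    by (simp_all add: algebra_simps)
  then show ?thesis
    by (simp only: F_fun_def F_conj_fun_def)
qed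

lemma integrand_reflected:
  "integrand \<epsilon> (\<lambda>x. f (c - x)) k \<phi> = integrand \<epsilon> f k (vec k (\<lambda>I. c - \<phi> $ I))"
proof -
  let ?P = "{(I, J). I < k \<and> J < k \<and> I \<noteq> J}"
  \<comment> \<open>Reflection reverses every difference of coordinates, and swapping the ordered
    pairs undoes this.\<close>
  have "(\<Prod>(I, J)\<in>?P. D_fun \<epsilon> (\<phi> $ I - \<phi> $ J)) = (\<Prod>(I, J)\<in>?P. D_fun \<epsilon> (\<phi> $ J - \<phi> $ I))"
    by (rule prod.reindex_bij_witness[where i = prod.swap and j = prod.swap]) auto
  also have "\<dots> = (\<Prod>(I, J)\<in>?P. D_fun \<epsilon>
      (vec k (\<lambda>I. c - \<phi> $ I) $ I - vec k (\<lambda>I. c - \<phi> $ I) $ J))"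
    by (intro prod.cong) auto
  finally show ?thesis
    by (simp add: integrand_def)
qed

section \<open>The singular hyperplanes under reflection\<close>

lemma charge_at_const:
  assumes "I < k"
  shows "charge_at (unit_vec k I) (vec k (\<lambda>_. c)) = c"
    and "charge_at (- unit_vec k I) (vec k (\<lambda>_. c)) = - c"
    and "J < k \<Longrightarrow> charge_at (unit_vec k I - unit_vec k J) (vec k (\<lambda>_. c)) = 0"
proof -
  have unit: "(\<Sum>L<k. unit_vec k I $ L) = (1 :: real)" if "I < k" for I
  proof -
    have "(\<Sum>L<k. unit_vec k I $ L) = (\<Sum>L<k. if L = I then 1 else 0 :: real)"
      using that by (intro sum.cong) auto
    then show ?thesis using that by simp
  qed
  \<comment> \<open>On a constant vector only the sum of the entries of the charge matters; it is 1,
    -1 or 0 for the three types of charge.\<close>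
  have charge: "charge_at Q (vec k (\<lambda>_. c)) = of_real (\<Sum>L<k. Q $ L) * c"
    if "Q \<in> carrier_vec k" for Q
    using that by (simp add: charge_at_eq_sum[of _ k] sum_distrib_right)
  show "charge_at (unit_vec k I) (vec k (\<lambda>_. c)) = c"
    using unit[OF assms] by (simp add: charge)
  have "(\<Sum>L<k. (- unit_vec k I) $ L) = (\<Sum>L<k. - (unit_vec k I $ L) :: real)"
    by (intro sum.cong) auto
  then show "charge_at (- unit_vec k I) (vec k (\<lambda>_. c)) = - c"
    using unit[OF assms] by (simp add: charge sum_negf)
  have "(\<Sum>L<k. (unit_vec k I - unit_vec k J) $ L)
      = (\<Sum>L<k. unit_vec k I $ L - unit_vec k J $ L :: real)"
    by (intro sum.cong) auto
  then show "charge_at (unit_vec k I - unit_vec k J) (vec k (\<lambda>_. c)) = 0" if "J < k"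
    using unit[OF assms] unit[OF that] by (simp add: charge sum_subtractf)
qed

text \<open>A difference of unit vectors vanishes on constant vectors, so the reflection merely
  exchanges \<open>I\<close> and \<open>J\<close> and keeps the constant.\<close>

lemma D_hyperplanes_reflected:
  "D_hyperplanes \<epsilon> k
     = (\<lambda>(Q, f). (- Q, f + charge_at Q (vec k (\<lambda>_. c)))) ` D_hyperplanes \<epsilon> k" (is "_ = ?r ` _")
proof -
  have swap: "(- (unit_vec k I - unit_vec k J) :: real vec) = unit_vec k J - unit_vec k I" for I J
    by (intro eq_vecI) auto
  have "?r (unit_vec k I - unit_vec k J, - \<epsilon> a) = (unit_vec k J - unit_vec k I, - \<epsilon> a)"
    if "I < k" "J < k" for I J a
    using charge_at_const(3)[OF that, of c] by (simp add: swap)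
  note r = this
  show ?thesis
  proof (intro equalityI subsetI)
    fix x assume "x \<in> D_hyperplanes \<epsilon> k"
    then obtain I J a where x: "x = (unit_vec k I - unit_vec k J, - \<epsilon> a)"
      and IJ: "I < k" "J < k" "I \<noteq> J" "a \<in> {1..4}"
      unfolding D_hyperplanes_def by blast
    have "x = ?r (unit_vec k J - unit_vec k I, - \<epsilon> a)"
      by (simp only: x r[OF IJ(2,1)])
    moreover have "(unit_vec k J - unit_vec k I, - \<epsilon> a) \<in> D_hyperplanes \<epsilon> k"
      unfolding D_hyperplanes_def using IJ by blast
    ultimately show "x \<in> ?r ` D_hyperplanes \<epsilon> k"
      by (rule image_eqI)
  next
    fix x assume "x \<in> ?r ` D_hyperplanes \<epsilon> k"
    then obtain I J a where x: "x = ?r (unit_vec k I - unit_vec k J, - \<epsilon> a)"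
      and IJ: "I < k" "J < k" "I \<noteq> J" "a \<in> {1..4}"
      unfolding D_hyperplanes_def by blast
    show "x \<in> D_hyperplanes \<epsilon> k"
      unfolding x r[OF IJ(1,2)] D_hyperplanes_def using IJ by blast
  qed
qed

text \<open>Adding \<open>2 * \<aa>\<close> for a concave corner and subtracting it for a convex one
  turns the constants of \<open>F_fun\<close> into those of \<open>F_conj_fun\<close>.\<close>

lemma F_conj_hyperplanes_eq:
  "F_conj_hyperplanes \<epsilon> \<aa> lam mu nu k
     = (\<lambda>(Q, f). (- Q, f + charge_at Q (vec k (\<lambda>_. 2 * \<aa>)))) ` F_hyperplanes \<epsilon> \<aa> lam mu nu k"
  (is "_ = ?r ` _")
proof -
  have r: "?r (unit_vec k I, - \<aa> - u) = (- unit_vec k I, \<aa> - u)"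
    "?r (- unit_vec k I, \<aa> + u + w) = (unit_vec k I, - \<aa> + u + w)" if "I < k" for I u w
    using that by (simp_all add: charge_at_const)
  have s: "?r ` {(unit_vec k I, - \<aa> - content \<epsilon> b) | I b. I < k \<and> b \<in> A}
      = {(- unit_vec k I, \<aa> - content \<epsilon> b) | I b. I < k \<and> b \<in> A}" (is "_ ` ?X = ?Y") for A
  proof -
    \<comment> \<open>Writing both families as images of one index set reduces the claim to a
      comparison of single hyperplanes.\<close>
    have "?X = (\<lambda>(I, b). (unit_vec k I, - \<aa> - content \<epsilon> b)) ` ({..<k} \<times> A)"
      "?Y = (\<lambda>(I, b). (- unit_vec k I, \<aa> - content \<epsilon> b)) ` ({..<k} \<times> A)"
      by auto
    then show ?thesis
      using r(1) by (simp only: image_image) (intro image_cong; force)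
  qed
  have p: "?r ` {(- unit_vec k I, \<aa> + content \<epsilon> b + \<epsilon> 4) | I b. I < k \<and> b \<in> A}
      = {(unit_vec k I, - \<aa> + content \<epsilon> b + \<epsilon> 4) | I b. I < k \<and> b \<in> A}"
    (is "_ ` ?X = ?Y") for A
  proof -
    have "?X = (\<lambda>(I, b). (- unit_vec k I, \<aa> + content \<epsilon> b + \<epsilon> 4)) ` ({..<k} \<times> A)"
      "?Y = (\<lambda>(I, b). (unit_vec k I, - \<aa> + content \<epsilon> b + \<epsilon> 4)) ` ({..<k} \<times> A)"
      by auto
    then show ?thesis
      using r(2) by (simp only: image_image) (intro image_cong; force)
  qed
  \<comment> \<open>The multiplicity \<open>m\<close> does not enter the hyperplane, so the convex
    families merge into one family over the union of the corner sets.\<close>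
  have merge: "{h I b | I b m. I < k \<and> m \<in> M \<and> b \<in> A m} = {h I b | I b. I < k \<and> b \<in> (\<Union>m\<in>M. A m)}"
    for h :: "nat \<Rightarrow> box \<Rightarrow> hyperplane" and A :: "nat \<Rightarrow> box set" and M
    by blast
  show ?thesis
    unfolding F_conj_hyperplanes_def F_hyperplanes_def merge image_Un s p
      D_hyperplanes_reflected[of \<epsilon> k "2 * \<aa>", symmetric] by (rule refl)
qed

lemma F_hyperplanes_charge:
  fixes Q :: "real vec"
  assumes "(Q, f) \<in> F_hyperplanes \<epsilon> \<aa> lam mu nu k"
  shows "Q \<in> carrier_vec k" and "I < k \<Longrightarrow> Q $ I \<in> \<int>"
  using assms by (auto simp: F_hyperplanes_def D_hyperplanes_def unit_vec_def)

lemma reflected_jk_PT3: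
  "reflected_jk k (2 * \<aa>) (F_hyperplanes \<epsilon> \<aa> lam mu nu k) (F_conj_hyperplanes \<epsilon> \<aa> lam mu nu k)
     (integrand \<epsilon> (F_fun \<epsilon> \<aa> lam mu nu) k) (integrand \<epsilon> (F_conj_fun \<epsilon> \<aa> lam mu nu) k)"
proof
  show "integrand \<epsilon> (F_conj_fun \<epsilon> \<aa> lam mu nu) k \<phi>
      = integrand \<epsilon> (F_fun \<epsilon> \<aa> lam mu nu) k (vec k (\<lambda>I. 2 * \<aa> - \<phi> $ I))" for \<phi>
    using integrand_reflected[of \<epsilon> "F_fun \<epsilon> \<aa> lam mu nu" "2 * \<aa>" k \<phi>]
    by (simp add: F_conj_fun_eq[abs_def])
  show "integrand \<epsilon> (F_fun \<epsilon> \<aa> lam mu nu) k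
        (vec k (\<lambda>I. \<phi> $ I + 2 * of_real pi * \<i> * of_int (n I)))
      = integrand \<epsilon> (F_fun \<epsilon> \<aa> lam mu nu) k \<phi>"
    if "\<phi> \<in> carrier_vec k" for \<phi> n
    using that F_fun_add_2pi by (rule integrand_periodic)
next
  show "F_conj_hyperplanes \<epsilon> \<aa> lam mu nu k
      = (\<lambda>(Q, f). (- Q, f + charge_at Q (vec k (\<lambda>_. 2 * \<aa>)))) ` F_hyperplanes \<epsilon> \<aa> lam mu nu k"
    by (rule F_conj_hyperplanes_eq)
next
  fix Q f assume Qf: "(Q, f) \<in> F_hyperplanes \<epsilon> \<aa> lam mu nu k"
  show "Q \<in> carrier_vec k" using Qf by (rule F_hyperplanes_charge(1))
  show "Q $ I \<in> \<int>" if "I < k" for I using Qf that by (rule F_hyperplanes_charge(2))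
qed

theorem mainTheorem4:
  fixes \<epsilon> :: "nat \<Rightarrow> complex" and \<aa> :: complex and lam mu nu :: "nat list"
  assumes "young_diagram lam" and "young_diagram mu" and "young_diagram nu"
    and "\<epsilon> 1 + \<epsilon> 2 + \<epsilon> 3 + \<epsilon> 4 = 0"
    and "generic_eps \<epsilon>"
  shows "\<forall>k. fps_nth (PT3 \<epsilon> \<aa> lam mu nu) k =
     1 / fact k * ((\<Prod>i\<in>{1..3}. sh (- \<epsilon> i - \<epsilon> 4)) / (\<Prod>a\<in>{1..4}. sh (- \<epsilon> a))) ^ k *
     jk_integral k (F_conj_hyperplanes \<epsilon> \<aa> lam mu nu k)
       (integrand \<epsilon> (F_conj_fun \<epsilon> \<aa> lam mu nu) k) (vec k (\<lambda>_. 1))"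
proof
  fix k
  interpret reflected_jk k "2 * \<aa>" "F_hyperplanes \<epsilon> \<aa> lam mu nu k" "F_conj_hyperplanes \<epsilon> \<aa> lam mu nu k"
    "integrand \<epsilon> (F_fun \<epsilon> \<aa> lam mu nu) k" "integrand \<epsilon> (F_conj_fun \<epsilon> \<aa> lam mu nu) k"
    by (rule reflected_jk_PT3)
  \<comment> \<open>The two reference vectors are opposite, as the reflection of the Jeffrey-Kirwan
    integral requires.\<close>
  have "vec k (\<lambda>_. 1 :: real) = - vec k (\<lambda>_. - 1)"
    by (intro eq_vecI) auto
  then have "jk_integral k (F_conj_hyperplanes \<epsilon> \<aa> lam mu nu k)
       (integrand \<epsilon> (F_conj_fun \<epsilon> \<aa> lam mu nu) k) (vec k (\<lambda>_. 1))
     = jk_integral k (F_hyperplanes \<epsilon> \<aa> lam mu nu k)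
       (integrand \<epsilon> (F_fun \<epsilon> \<aa> lam mu nu) k) (vec k (\<lambda>_. - 1))"
    using jk_integral_reflect[OF vec_carrier, of "\<lambda>_. - 1"] by metis
  then show "fps_nth (PT3 \<epsilon> \<aa> lam mu nu) k =
     1 / fact k * ((\<Prod>i\<in>{1..3}. sh (- \<epsilon> i - \<epsilon> 4)) / (\<Prod>a\<in>{1..4}. sh (- \<epsilon> a))) ^ k *
     jk_integral k (F_conj_hyperplanes \<epsilon> \<aa> lam mu nu k)
       (integrand \<epsilon> (F_conj_fun \<epsilon> \<aa> lam mu nu) k) (vec k (\<lambda>_. 1))"
    unfolding PT3_def PT3_coeff_def PT3_prefactor_def fps_nth_Abs_fps by (rule ssubst) (rule refl)
qed

end
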